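(* There exist a real number $b > 1$ and two absolutely continuous Borel probability measures $P_1, P_2$ on $\mathbb{R}$ with support contained in $[1, b]$, having continuous density functions $f, g: \mathbb{R} \to [0,\infty)$ and distribution functions $F, G$, respectively, such that $P_1 \prec_{\text{tail}} P_2$, the densities $f$ and $g$ alternate on $[1, b]$, and the distribution functions $F$ and $G$ alternate on $[1, b]$.
   Context: Two functions $f, g: \mathbb{R} \to \mathbb{R}$ alternate on an interval $[a, b]$ if for every $x_0 \in (a, b)$ there are $x_1, x_2 \in (x_0, b)$ such that $f(x_1) < g(x_1)$ and $f(x_2) > g(x_2)$. The distribution function of $P$ is $x \mapsto P((-\infty, x])$. For Borel probability measures $P$ on $\mathbb{R}$ having moments of all orders, let $m_k(P) = \int x^k \, dP(x)$, $k \in \mathbb{N}_0$. The stochastic tail order: $P \preccurlyeq_{\text{tail}} Q$ iff $P = Q$, or ($P, Q$ have moments of all orders and $m_k(P) \leq m_k(Q)$ for all but finitely many $k \in \mathbb{N}_0$). $P \prec_{\text{tail}} Q$ means $P \preccurlyeq_{\text{tail}} Q$ and not $Q \preccurlyeq_{\text{tail}} P$. *)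

theory Defs
  imports "HOL-Probability.Probability"
begin

definition alternate_on :: "real \<Rightarrow> real \<Rightarrow> (real \<Rightarrow> real) \<Rightarrow> (real \<Rightarrow> real) \<Rightarrow> bool" where
  "alternate_on a b f g \<longleftrightarrow>
     (\<forall>x0\<in>{a<..<b}. \<exists>x1\<in>{x0<..<b}. \<exists>x2\<in>{x0<..<b}. f x1 < g x1 \<and> f x2 > g x2)"

definition has_all_moments :: "real measure \<Rightarrow> bool" where
  "has_all_moments P \<longleftrightarrow> (\<forall>k::nat. integrable P (\<lambda>x. x ^ k))"

definition moment :: "nat \<Rightarrow> real measure \<Rightarrow> real" where
  "moment k P = integral\<^sup>L P (\<lambda>x. x ^ k)"

text \<open>The stochastic tail order; it is meant for Borel probability measures on the reals, that is,
  for measures satisfying \<^const>\<open>real_distribution\<close>.\<close>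

definition tail_le :: "real measure \<Rightarrow> real measure \<Rightarrow> bool"  (infix "\<preceq>\<^sub>t\<^sub>a\<^sub>i\<^sub>l" 50) where
  "P \<preceq>\<^sub>t\<^sub>a\<^sub>i\<^sub>l Q \<longleftrightarrow>
     P = Q \<or>
     (has_all_moments P \<and> has_all_moments Q \<and> finite {k. \<not> moment k P \<le> moment k Q})"

definition tail_less :: "real measure \<Rightarrow> real measure \<Rightarrow> bool"  (infix "\<prec>\<^sub>t\<^sub>a\<^sub>i\<^sub>l" 50) where
  "P \<prec>\<^sub>t\<^sub>a\<^sub>i\<^sub>l Q \<longleftrightarrow> P \<preceq>\<^sub>t\<^sub>a\<^sub>i\<^sub>l Q \<and> \<not> Q \<preceq>\<^sub>t\<^sub>a\<^sub>i\<^sub>l P"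

definition topological_support :: "real measure \<Rightarrow> real set" where
  "topological_support P = {x. \<forall>U. open U \<and> x \<in> U \<longrightarrow> emeasure P U > 0}"

definition has_continuous_density :: "real measure \<Rightarrow> (real \<Rightarrow> real) \<Rightarrow> bool" where
  "has_continuous_density P f \<longleftrightarrow>
     continuous_on UNIV f \<and> (\<forall>x. 0 \<le> f x) \<and> P = density lborel (\<lambda>x. ennreal (f x))"

end

theory Submission
  imports Defs
begin

text \<open>If \<open>K \<ge> 0\<close> is twice continuously differentiable and \<open>K\<close>, \<open>K'\<close>, \<open>K''\<close> vanish at \<open>1\<close> and
  \<open>2\<close>, two integrations by parts give \<open>\<integral> x\<^sup>k K'' = k (k - 1) \<integral> x\<^sup>k\<^sup>-\<^sup>2 K > 0\<close> for \<open>k \<ge> 2\<close>.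
  So it suffices to take the normalised negative and positive parts of \<open>K''\<close> as the two densities,
  for a \<open>K\<close> that has infinitely many zeros and bumps accumulating at \<open>2\<close>: by the mean value
  theorem, first \<open>K'\<close>, which is proportional to the difference of the distribution functions, and
  then \<open>K''\<close> alternate in sign near \<open>2\<close>.\<close>

section \<open>Sign alternation of derivatives\<close>

text \<open>The mean value theorem turns a rise of \<open>\<phi>\<close> into a positive value of
  \<open>\<phi>'\<close> and a fall into a negative one. Rises and falls are assumed, rather than
  changes of sign, so that the lemma applies to the nonnegative \<open>bump\<close>.\<close>

lemma alternate_on_deriv:
  fixes \<phi> :: "real \<Rightarrow> real"
  assumes deriv: "\<And>x. (\<phi> has_real_derivative \<phi>' x) (at x)"
    and up: "\<And>x0. x0 \<in> {a<..<b} \<Longrightarrow> \<exists>u v. x0 < u \<and> u < v \<and> v < b \<and> \<phi> u < \<phi> v"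
    and down: "\<And>x0. x0 \<in> {a<..<b} \<Longrightarrow> \<exists>u v. x0 < u \<and> u < v \<and> v < b \<and> \<phi> v < \<phi> u"
  shows "alternate_on a b \<phi>' (\<lambda>_. 0)"
  unfolding alternate_on_def
proof
  fix x0 assume x0: "x0 \<in> {a<..<b}"
  obtain u v where uv: "x0 < u" "u < v" "v < b" "\<phi> u < \<phi> v" using up[OF x0] by blast
  obtain z where z: "u < z" "z < v" "\<phi> v - \<phi> u = (v - u) * \<phi>' z"
    using MVT2[OF uv(2), of \<phi> \<phi>'] deriv by blast
  have z_pos: "\<phi>' z > 0" using uv z by (smt (verit) mult_nonneg_nonpos)
  obtain u' v' where uv': "x0 < u'" "u' < v'" "v' < b" "\<phi> v' < \<phi> u'" using down[OF x0] by blast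
  obtain z' where z': "u' < z'" "z' < v'" "\<phi> v' - \<phi> u' = (v' - u') * \<phi>' z'"
    using MVT2[OF uv'(2), of \<phi> \<phi>'] deriv by blast
  have z'_neg: "\<phi>' z' < 0" using uv' z' by (smt (verit) mult_nonneg_nonneg)
  show "\<exists>x1\<in>{x0<..<b}. \<exists>x2\<in>{x0<..<b}. \<phi>' x1 < 0 \<and> 0 < \<phi>' x2"
    by (rule bexI[of _ z'], rule bexI[of _ z]) (use uv uv' z z' z_pos z'_neg in auto)
qed

text \<open>Three successive points with signs -, +, - exhibit both a rise and a fall.\<close>

lemma alternate_on_deriv_of_alternate_on:
  fixes \<phi> :: "real \<Rightarrow> real"
  assumes deriv: "\<And>x. (\<phi> has_real_derivative \<phi>' x) (at x)"
    and alt: "alternate_on a b \<phi> (\<lambda>_. 0)"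
  shows "alternate_on a b \<phi>' (\<lambda>_. 0)"
proof (rule alternate_on_deriv[OF deriv])
  fix x0 assume "x0 \<in> {a<..<b}"
  then obtain x1 where x1: "x0 < x1" "x1 < b" "\<phi> x1 < 0" "x1 \<in> {a<..<b}"
    using alt unfolding alternate_on_def by fastforce
  then obtain x2 where x2: "x1 < x2" "x2 < b" "\<phi> x2 > 0" "x2 \<in> {a<..<b}"
    using alt unfolding alternate_on_def by fastforce
  then obtain x3 where x3: "x2 < x3" "x3 < b" "\<phi> x3 < 0"
    using alt unfolding alternate_on_def by fastforce
  show "\<exists>u v. x0 < u \<and> u < v \<and> v < b \<and> \<phi> u < \<phi> v"
    by (rule exI[of _ x1], rule exI[of _ x2]) (use x1 x2 in auto)
  show "\<exists>u v. x0 < u \<and> u < v \<and> v < b \<and> \<phi> v < \<phi> u"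
    by (rule exI[of _ x2], rule exI[of _ x3]) (use x1 x2 x3 in auto)
qed

section \<open>An oscillating function near 0 and its derivatives\<close>

text \<open>The factor \<open>s\<close> damps the oscillation: the product is bounded by
  \<open>\<bar>s\<bar>\<close>, so its limit at 0 is its value there.\<close>

lemma isCont_mult_cos_inverse: "isCont (\<lambda>s::real. s * cos (1 / s)) x"
proof (cases "x = 0")
  case True
  have "((\<lambda>s::real. s * cos (1 / s)) \<longlongrightarrow> 0) (at 0)"
    by (rule Lim_null_comparison[where g = "\<lambda>s. \<bar>s\<bar>"])
      (auto simp: abs_mult mult_left_le intro!: always_eventually tendsto_eq_intros)
  then show ?thesis using True by (simp add: isCont_def)
qed (auto intro!: continuous_intros)

lemma isCont_mult_sin_inverse: "isCont (\<lambda>s::real. s * sin (1 / s)) x"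
proof (cases "x = 0")
  case True
  have "((\<lambda>s::real. s * sin (1 / s)) \<longlongrightarrow> 0) (at 0)"
    by (rule Lim_null_comparison[where g = "\<lambda>s. \<bar>s\<bar>"])
      (auto simp: abs_mult mult_left_le intro!: always_eventually tendsto_eq_intros)
  then show ?thesis using True by (simp add: isCont_def)
qed (auto intro!: continuous_intros)

text \<open>The convention \<open>1 / 0 = 0\<close> gives the following functions their limit \<open>0\<close> at \<open>0\<close>. The factor
  \<open>s\<close> is kept next to \<open>cos (1 / s)\<close> and \<open>sin (1 / s)\<close>, so that each function is visibly continuous.\<close>

definition osc :: "real \<Rightarrow> real" where
  "osc s = s ^ 5 * (s - s * cos (1 / s))"

definition osc' :: "real \<Rightarrow> real" where
  "osc' s = 6 * s ^ 4 * (s - s * cos (1 / s)) - s ^ 3 * (s * sin (1 / s))"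

definition osc'' :: "real \<Rightarrow> real" where
  "osc'' s = 30 * s ^ 3 * (s - s * cos (1 / s)) - 10 * s ^ 2 * (s * sin (1 / s))
     + s * (s * cos (1 / s))"

lemma osc_0 [simp]: "osc 0 = 0" "osc' 0 = 0" "osc'' 0 = 0"
  by (simp_all add: osc_def osc'_def osc''_def)

lemma isCont_osc'': "isCont osc'' s"
  unfolding osc''_def
  by (intro continuous_intros isCont_mult_cos_inverse isCont_mult_sin_inverse)

lemma has_real_derivative_osc: "(osc has_real_derivative osc' s) (at s)"
proof (cases "s = 0")
  case True
  \<comment> \<open>Caratheodory's criterion: \<open>g\<close> is the difference quotient of
    \<open>osc\<close> at 0, extended continuously, and its value at 0 is the derivative.\<close>
  define g where "g s = s ^ 4 * (s - s * cos (1 / s))" for s :: real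
  have "osc z - osc 0 = g z * (z - 0)" for z
    by (simp add: osc_def g_def power_numeral_reduce)
  moreover have "isCont g 0"
    unfolding g_def by (intro continuous_intros isCont_mult_cos_inverse)
  moreover have "g 0 = 0" by (simp add: g_def)
  ultimately show ?thesis using True by (auto simp: CARAT_DERIV)
next
  case False
  then show ?thesis
    unfolding osc_def osc'_def
    by - ((rule derivative_eq_intros refl | assumption)+,
        simp add: field_simps power_numeral_reduce)
qed

lemma has_real_derivative_osc': "(osc' has_real_derivative osc'' s) (at s)"
proof (cases "s = 0")
  case True
  define g where "g s = 6 * s ^ 3 * (s - s * cos (1 / s)) - s ^ 2 * (s * sin (1 / s))"
    for s :: real
  have "osc' z - osc' 0 = g z * (z - 0)" for z
    by (simp add: osc'_def g_def power_numeral_reduce algebra_simps)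
  moreover have "isCont g 0"
    unfolding g_def
    by (intro continuous_intros isCont_mult_cos_inverse isCont_mult_sin_inverse)
  moreover have "g 0 = 0" by (simp add: g_def)
  ultimately show ?thesis using True by (auto simp: CARAT_DERIV)
next
  case False
  then show ?thesis
    unfolding osc'_def osc''_def
    by (auto intro!: derivative_eq_intros simp: field_simps power_numeral_reduce)
qed

lemma osc_nonneg: "s \<ge> 0 \<Longrightarrow> osc s \<ge> 0"
  unfolding osc_def by (simp add: mult_left_le)

lemma osc_even: "osc (1 / (2 * pi * real n)) = 0"
  using cos_int_2pin[of "int n"] by (simp add: osc_def)

text \<open>At odd multiples of \<open>pi\<close> the cosine is -1, so \<open>osc s\<close> equals
  \<open>2 * s ^ 6\<close>.\<close>

lemma osc_odd: "osc (1 / (2 * pi * real n + pi)) > 0"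
proof -
  have "cos (2 * pi * real n + pi) = - 1"
    using cos_int_2pin[of "int n"] by simp
  moreover have "2 * pi * real n + pi > 0" by (simp add: add_nonneg_pos)
  ultimately show ?thesis by (simp add: osc_def)
qed

section \<open>The function with bumps accumulating at 2\<close>

text \<open>This is the \<open>K\<close> of the outline. The reflection \<open>2 - x\<close> moves
  the oscillation to the left of 2, and the cubic factor makes the first two derivatives vanish at
  1. Differentiating \<open>cos (1 / s)\<close> costs a factor \<open>s ^ 2\<close> each time, so
  the order 6 of \<open>osc\<close> leaves a continuous second derivative.\<close>

definition bump :: "real \<Rightarrow> real" where
  "bump x = (x - 1) ^ 3 * osc (2 - x)"

definition bump' :: "real \<Rightarrow> real" where
  "bump' x = 3 * (x - 1) ^ 2 * osc (2 - x) - (x - 1) ^ 3 * osc' (2 - x)"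

definition bump'' :: "real \<Rightarrow> real" where
  "bump'' x = 6 * (x - 1) * osc (2 - x) - 6 * (x - 1) ^ 2 * osc' (2 - x)
     + (x - 1) ^ 3 * osc'' (2 - x)"

lemma bump_ends [simp]:
  "bump 1 = 0" "bump 2 = 0" "bump' 1 = 0" "bump' 2 = 0" "bump'' 1 = 0" "bump'' 2 = 0"
  by (simp_all add: bump_def bump'_def bump''_def)

lemma has_real_derivative_bump: "(bump has_real_derivative bump' x) (at x)"
  unfolding bump_def bump'_def
  by (auto intro!: derivative_eq_intros DERIV_chain2[OF has_real_derivative_osc]
      simp: algebra_simps)

lemma has_real_derivative_bump': "(bump' has_real_derivative bump'' x) (at x)"
  unfolding bump'_def bump''_def
  by (auto intro!: derivative_eq_intros DERIV_chain2[OF has_real_derivative_osc]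
      DERIV_chain2[OF has_real_derivative_osc'] simp: algebra_simps)

lemma continuous_on_bump'' [continuous_intros]: "continuous_on A bump''"
proof -
  have [continuous_intros]: "isCont (\<lambda>x. osc (2 - x)) x" "isCont (\<lambda>x. osc' (2 - x)) x"
    "isCont (\<lambda>x. osc'' (2 - x)) x" for x
    using DERIV_isCont[OF has_real_derivative_osc] DERIV_isCont[OF has_real_derivative_osc']
      isCont_osc''
    by (auto intro!: isCont_o2[where f = "\<lambda>x. 2 - x"] continuous_intros)
  show ?thesis
    unfolding bump''_def by (intro continuous_at_imp_continuous_on ballI continuous_intros)
qed

lemma bump_nonneg: "x \<in> {1..2} \<Longrightarrow> bump x \<ge> 0"
  unfolding bump_def by (simp add: osc_nonneg)

text \<open>Beyond any \<open>x0\<close> there are two zeros \<open>u < w\<close> of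
  \<open>bump\<close> with a point \<open>v\<close> between them where \<open>bump\<close> is
  positive: a rise followed by a fall.\<close>

lemma alternate_on_bump': "alternate_on 1 2 bump' (\<lambda>_. 0)"
proof -
  have bumps: "\<exists>u v w. x0 < u \<and> u < v \<and> v < w \<and> w < 2 \<and> bump u < bump v \<and> bump w < bump v"
    if x0: "x0 \<in> {1<..<2}" for x0
  proof -
    \<comment> \<open>A large \<open>n\<close> puts the zero \<open>u\<close> to the right of
      \<open>x0\<close>, since \<open>1 / (2 * pi * n) < 1 / n < 2 - x0\<close>.\<close>
    obtain n :: nat where n: "1 / (2 - x0) < real n" using reals_Archimedean2 by blast
    have "n > 0" using n x0 by (cases n) (auto simp: not_less divide_less_0_iff)
    define u where "u = 2 - 1 / (2 * pi * real n)"
    define v where "v = 2 - 1 / (2 * pi * real n + pi)"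
    define w where "w = 2 - 1 / (2 * pi * real (Suc n))"
    have "real n < 2 * pi * real n"
      using \<open>n > 0\<close> pi_ge_two by simp
    then have "1 / (2 - x0) < 2 * pi * real n" using n by linarith
    then have "x0 < u" using x0 \<open>n > 0\<close> by (simp add: u_def field_simps)
    moreover have "u < v" using \<open>n > 0\<close>
      unfolding u_def v_def by (auto intro!: divide_strict_left_mono mult_pos_pos add_pos_pos)
    moreover have "v < w"
      unfolding v_def w_def using \<open>n > 0\<close>
      by (auto simp: algebra_simps intro!: divide_strict_left_mono mult_pos_pos add_pos_pos)
    moreover have "w < 2" by (simp add: w_def)
    moreover have "bump u = 0" using osc_even[of n] by (simp add: bump_def u_def)
    moreover have "bump w = 0" using osc_even[of "Suc n"] by (simp add: bump_def w_def)
    moreover have "bump v > 0"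
      using osc_odd[of n] x0 \<open>x0 < u\<close> \<open>u < v\<close> unfolding bump_def
      by (intro mult_pos_pos) (auto simp: v_def)
    ultimately show ?thesis by fastforce
  qed
  show ?thesis
    by (rule alternate_on_deriv[OF has_real_derivative_bump]) (use bumps in \<open>meson less_trans\<close>)+
qed

lemma alternate_on_bump'': "alternate_on 1 2 bump'' (\<lambda>_. 0)"
  using alternate_on_deriv_of_alternate_on[OF has_real_derivative_bump' alternate_on_bump'] .

text \<open>Serves to make the moment inequalities strict. The witness comes from the odd multiple
  \<open>3 * pi\<close>.\<close>

lemma bump_not_zero: "\<exists>x\<in>{1..2}. bump x \<noteq> 0"
proof -
  have "1 / (3 * pi) < 1" using pi_ge_two by (simp add: field_simps)
  moreover have "osc (1 / (3 * pi)) > 0" using osc_odd[of 1] by (simp add: algebra_simps)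
  ultimately show ?thesis
    by (intro bexI[of _ "2 - 1 / (3 * pi)"]) (auto simp: bump_def)
qed

section \<open>Extension of the second derivative by zero, and its integrals\<close>

definition cut_bump'' :: "real \<Rightarrow> real" where
  "cut_bump'' x = bump'' x * indicator {1..2} x"

lemma cut_bump''_outside: "\<forall>x. x \<notin> {1..2} \<longrightarrow> cut_bump'' x = 0"
  by (simp add: cut_bump''_def)

lemma continuous_on_cut_bump'': "continuous_on A cut_bump''"
proof -
  \<comment> \<open>Clamping the argument to [1, 2] agrees with extension by zero because
    \<open>bump''\<close> vanishes at both ends.\<close>
  have eq: "cut_bump'' = (\<lambda>x. bump'' (max 1 (min 2 x)))"
    by (auto simp: cut_bump''_def fun_eq_iff indicator_def max_def min_def)
  show ?thesis
    by (subst eq)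
      (auto intro!: continuous_on_compose2[OF continuous_on_bump''[of UNIV]] continuous_intros)
qed

lemma has_bochner_integral_cut_bump''_atMost:
  assumes "x \<in> {1..2}"
  shows "has_bochner_integral lborel (\<lambda>t. cut_bump'' t * indicator {..x} t) (bump' x)"
proof -
  have "has_bochner_integral lborel (\<lambda>t. bump'' t * indicator {1..x} t) (bump' x - bump' 1)"
    using assms continuous_on_bump''[of UNIV]
    by (intro has_bochner_integral_FTC_Icc_real has_real_derivative_bump')
      (auto simp: continuous_on_eq_continuous_at)
  moreover have "(\<lambda>t. cut_bump'' t * indicator {..x} t) = (\<lambda>t. bump'' t * indicator {1..x} t)"
    using assms by (auto simp: cut_bump''_def indicator_def)
  ultimately show ?thesis by simp
qed

text \<open>The value is \<open>bump' 2\<close>; it being 0 gives the positive and negative parts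
  the same integral.\<close>

lemma has_bochner_integral_cut_bump'': "has_bochner_integral lborel cut_bump'' 0"
proof -
  have "(\<lambda>t. cut_bump'' t * indicator {..2} t) = cut_bump''"
    by (auto simp: cut_bump''_def indicator_def)
  with has_bochner_integral_cut_bump''_atMost[of 2] show ?thesis by simp
qed

lemma integrable_continuous_indicator:
  fixes \<phi> :: "real \<Rightarrow> real"
  assumes "continuous_on UNIV \<phi>"
  shows "integrable lborel (\<lambda>x. \<phi> x * indicator {a..b} x)"
  using assms by (intro borel_integrable_atLeastAtMost) (auto simp: continuous_on_eq_continuous_at)

text \<open>Two integrations by parts move both derivatives from \<open>bump\<close> to the power.
  The exponent \<open>k + 2\<close> avoids truncated subtraction.\<close>

lemma integral_power_cut_bump''_pos:
  "(\<integral>x. x ^ (k + 2) * cut_bump'' x \<partial>lborel) > 0"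
proof -
  \<comment> \<open>\<open>A\<close> collects the boundary terms of both integrations by parts and
    vanishes at 1 and 2; \<open>w\<close> is the integrand that remains.\<close>
  define A where "A x = x ^ (k + 2) * bump' x - real (k + 2) * x ^ (k + 1) * bump x" for x
  define w where "w x = real (k + 2) * real (k + 1) * x ^ k * bump x" for x
  have cont: "continuous_on S bump" for S
    by (meson DERIV_continuous_on has_real_derivative_bump has_field_derivative_at_within)
  have cont_w: "continuous_on S w" for S
    unfolding w_def by (intro continuous_intros cont)
  have A: "(A has_real_derivative x ^ (k + 2) * bump'' x - w x) (at x)" for x
    unfolding A_def w_def
    by (rule derivative_eq_intros has_real_derivative_bump has_real_derivative_bump' refl)+
      (simp add: algebra_simps)
  have "has_bochner_integral lborel (\<lambda>x. (x ^ (k + 2) * bump'' x - w x) * indicator {1..2} x)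
      (A 2 - A 1)"
    using cont_w[of UNIV] continuous_on_bump''[of UNIV]
    by (intro has_bochner_integral_FTC_Icc_real A)
      (auto simp: continuous_on_eq_continuous_at intro!: continuous_intros)
  moreover have "A 2 - A 1 = 0" by (simp add: A_def)
  moreover have int_w: "integrable lborel (\<lambda>x. w x * indicator {1..2} x)"
    by (rule integrable_continuous_indicator[OF cont_w])
  ultimately have "has_bochner_integral lborel
      (\<lambda>x. (x ^ (k + 2) * bump'' x - w x) * indicator {1..2} x + w x * indicator {1..2} x)
      (0 + (\<integral>x. w x * indicator {1..2} x \<partial>lborel))"
    by (intro has_bochner_integral_add has_bochner_integral_integrable) auto
  then have eq: "(\<integral>x. x ^ (k + 2) * cut_bump'' x \<partial>lborel) = (\<integral>x. w x * indicator {1..2} x \<partial>lborel)"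
    by (auto simp: cut_bump''_def algebra_simps dest!: has_bochner_integral_integral_eq)
  \<comment> \<open>Passing to the gauge integral allows \<open>integral_eq_0_iff\<close>: a
    continuous nonnegative function with integral 0 vanishes on the interval.\<close>
  have "(LINT x : {1..2} | lborel. w x) = integral {1..2} w"
    by (intro set_borel_integral_eq_integral borel_integrable_atLeastAtMost' cont_w)
  moreover have w_nonneg: "w x \<ge> 0" if "x \<in> {1..2}" for x
    using that bump_nonneg[OF that] by (auto simp: w_def)
  then have "integral {1..2} w \<ge> 0"
    by (intro integral_nonneg integrable_continuous_real cont_w) auto
  moreover have "integral {1..2} w \<noteq> 0"
  proof -
    obtain x where "x \<in> {1..2}" "bump x \<noteq> 0" using bump_not_zero by blast
    then have "w x \<noteq> 0" by (auto simp: w_def)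
    with \<open>x \<in> {1..2}\<close> show ?thesis
      using integral_eq_0_iff[of 1 2 w] cont_w w_nonneg by auto
  qed
  ultimately show ?thesis
    unfolding eq by (simp add: set_lebesgue_integral_def mult.commute)
qed

section \<open>The normalising constant\<close>

definition mass :: real where
  "mass = (\<integral>x. max 0 (cut_bump'' x) \<partial>lborel)"

lemma integrable_cut_bump''_parts [intro]:
  "integrable lborel (\<lambda>x. max 0 (cut_bump'' x))" "integrable lborel (\<lambda>x. max 0 (- cut_bump'' x))"
  using has_bochner_integral_cut_bump'' by (auto simp: has_bochner_integral_iff)

lemma mass_neg: "(\<integral>x. max 0 (- cut_bump'' x) \<partial>lborel) = mass"
proof -
  have "mass - (\<integral>x. max 0 (- cut_bump'' x) \<partial>lborel)
      = (\<integral>x. max 0 (cut_bump'' x) - max 0 (- cut_bump'' x) \<partial>lborel)"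
    unfolding mass_def by (simp add: integrable_cut_bump''_parts)
  also have "(\<lambda>x. max 0 (cut_bump'' x) - max 0 (- cut_bump'' x)) = cut_bump''" by auto
  finally show ?thesis using has_bochner_integral_cut_bump'' by (simp add: has_bochner_integral_iff)
qed

lemma integrable_power_mult:
  assumes "continuous_on UNIV \<phi>" "\<forall>x. x \<notin> {1..2} \<longrightarrow> \<phi> x = 0"
  shows "integrable lborel (\<lambda>x::real. \<phi> x * x ^ k :: real)"
proof -
  have "integrable lborel (\<lambda>x. (\<phi> x * x ^ k) * indicator {1..2} x)"
    by (intro integrable_continuous_indicator continuous_intros assms(1))
  moreover have "(\<lambda>x. (\<phi> x * x ^ k) * indicator {1..2} x) = (\<lambda>x. \<phi> x * x ^ k)"
    using assms(2) by (auto simp: indicator_def fun_eq_iff)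
  ultimately show ?thesis by simp
qed

text \<open>On [1, 2] the factor \<open>x ^ 2\<close> is at most 4, so the positive second moment of
  \<open>cut_bump''\<close> is at most \<open>4 * mass\<close>.\<close>

lemma mass_pos: "mass > 0"
proof -
  have "(\<integral>x. x ^ (0 + 2) * cut_bump'' x \<partial>lborel) \<le> (\<integral>x. 4 * max 0 (cut_bump'' x) \<partial>lborel)"
  proof (rule integral_mono)
    show "integrable lborel (\<lambda>x. x ^ (0 + 2) * cut_bump'' x)"
      using integrable_power_mult[OF continuous_on_cut_bump'' cut_bump''_outside, of 2]
      by (simp add: mult.commute power2_eq_square)
    show "integrable lborel (\<lambda>x. 4 * max 0 (cut_bump'' x))" by auto
    fix x :: real
    show "x ^ (0 + 2) * cut_bump'' x \<le> 4 * max 0 (cut_bump'' x)"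
    proof (cases "x \<in> {1..2} \<and> cut_bump'' x \<ge> 0")
      case True
      then have "x ^ 2 \<le> 2 ^ 2" by (intro power_mono) auto
      then have "x ^ 2 * cut_bump'' x \<le> 4 * cut_bump'' x" using True by (intro mult_right_mono) auto
      then show ?thesis using True by (simp add: power2_eq_square)
    next
      case False
      then have "cut_bump'' x \<le> 0" by (cases "x \<in> {1..2}") (auto simp: cut_bump''_def)
      then show ?thesis by (simp add: mult_nonneg_nonpos)
    qed
  qed
  then show ?thesis using integral_power_cut_bump''_pos[of 0] by (simp add: mass_def)
qed

section \<open>Measures with a continuous density vanishing outside [1, 2]\<close>

lemma density_properties:
  fixes f :: "real \<Rightarrow> real"
  defines "P \<equiv> density lborel (\<lambda>x. ennreal (f x))"
  assumes cont: "continuous_on UNIV f" and nonneg: "\<And>x. f x \<ge> 0"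
    and outside: "\<forall>x. x \<notin> {1..2} \<longrightarrow> f x = 0"
    and int: "(\<integral>x. f x \<partial>lborel) = 1"
  shows "real_distribution P" "absolutely_continuous lborel P"
    "topological_support P \<subseteq> {1..2}" "has_continuous_density P f" "has_all_moments P"
    "moment k P = (\<integral>x. f x * x ^ k \<partial>lborel)"
    "cdf P x = (\<integral>t. f t * indicator {..x} t \<partial>lborel)"
proof -
  have [measurable]: "f \<in> borel_measurable borel"
    using cont by (rule borel_measurable_continuous_onI)
  have integrable: "integrable lborel (\<lambda>x. f x * x ^ k)" for k
    by (rule integrable_power_mult[OF cont outside])
  have "emeasure P UNIV = (\<integral>\<^sup>+ x. ennreal (f x) \<partial>lborel)"
    by (simp add: P_def emeasure_density)
  also have "\<dots> = 1"
    using integrable[of 0] int nonneg by (subst nn_integral_eq_integral) auto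
  finally interpret prob_space P
    by (intro prob_spaceI) (simp add: P_def)
  show "real_distribution P"
    by unfold_locales (simp_all add: P_def)
  show "absolutely_continuous lborel P"
    unfolding P_def by (rule absolutely_continuousI_density) measurable
  show "has_continuous_density P f"
    unfolding has_continuous_density_def P_def using cont nonneg by simp
  show "topological_support P \<subseteq> {1..2}"
  proof (rule ccontr)
    \<comment> \<open>The complement of [1, 2] is an open null set, so it contains no point of the
      support.\<close>
    assume "\<not> ?thesis"
    then obtain x where x: "x \<in> topological_support P" "x \<in> - {1..2}" by blast
    have "emeasure P (- {1..2}) = (\<integral>\<^sup>+ x. ennreal (f x) * indicator (- {1..2}) x \<partial>lborel)"
      by (simp add: P_def emeasure_density)
    also have "\<dots> = (\<integral>\<^sup>+ x. 0 \<partial>(lborel :: real measure))"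
    proof (rule nn_integral_cong)
      show "ennreal (f t) * indicator (- {1..2}) t = 0" for t
        using outside by (cases "t \<in> {1..2}") simp_all
    qed
    finally have "emeasure P (- {1..2}) = 0" by simp
    moreover have "emeasure P (- {1..2}) > 0"
      using x open_Compl[OF closed_atLeastAtMost] unfolding topological_support_def by blast
    ultimately show False by simp
  qed
  show "has_all_moments P"
    unfolding has_all_moments_def P_def using integrable nonneg
    by (simp add: integrable_density)
  show "moment k P = (\<integral>x. f x * x ^ k \<partial>lborel)"
    unfolding moment_def P_def using nonneg by (simp add: integral_density)
  have "space P = UNIV" by (simp add: P_def)
  then have "cdf P x = (\<integral>t. indicator {..x} t \<partial>P)"
    by (simp add: cdf_def)
  also have "\<dots> = (\<integral>t. f t * indicator {..x} t \<partial>lborel)"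
    unfolding P_def using nonneg by (subst integral_density) simp_all
  finally show "cdf P x = (\<integral>t. f t * indicator {..x} t \<partial>lborel)" .
qed

section \<open>The two measures and their comparison\<close>

theorem mainTheorem5:
  shows "\<exists>(b::real) (P1::real measure) (P2::real measure) (f::real \<Rightarrow> real) (g::real \<Rightarrow> real).
    b > 1 \<and>
    real_distribution P1 \<and> real_distribution P2 \<and>
    absolutely_continuous lborel P1 \<and> absolutely_continuous lborel P2 \<and>
    topological_support P1 \<subseteq> {1..b} \<and> topological_support P2 \<subseteq> {1..b} \<and>
    has_continuous_density P1 f \<and> has_continuous_density P2 g \<and>
    P1 \<prec>\<^sub>t\<^sub>a\<^sub>i\<^sub>l P2 \<and>
    alternate_on 1 b f g \<and>
    alternate_on 1 b (cdf P1) (cdf P2)"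
proof -
  \<comment> \<open>The negative part goes to \<open>P1\<close>, so that \<open>g - f\<close> is a
    positive multiple of \<open>cut_bump''\<close> and the moments of \<open>P2\<close> are the
    larger ones.\<close>
  define f where "f x = max 0 (- cut_bump'' x) / mass" for x
  define g where "g x = max 0 (cut_bump'' x) / mass" for x
  define P1 where "P1 = density lborel (\<lambda>x. ennreal (f x))"
  define P2 where "P2 = density lborel (\<lambda>x. ennreal (g x))"
  have diff: "g x - f x = cut_bump'' x / mass" for x
    by (simp add: f_def g_def max_def flip: diff_divide_distrib)
  have f: "continuous_on UNIV f" "f x \<ge> 0" "\<forall>x. x \<notin> {1..2} \<longrightarrow> f x = 0" "(\<integral>x. f x \<partial>lborel) = 1" for x
    unfolding f_def using mass_pos mass_neg
    by (auto intro!: continuous_intros continuous_on_cut_bump'' simp: cut_bump''_outside)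
  have g: "continuous_on UNIV g" "g x \<ge> 0" "\<forall>x. x \<notin> {1..2} \<longrightarrow> g x = 0" "(\<integral>x. g x \<partial>lborel) = 1" for x
    unfolding g_def using mass_pos
    by (auto intro!: continuous_intros continuous_on_cut_bump'' simp: cut_bump''_outside mass_def)
  note P1 = density_properties[OF f, folded P1_def]
  note P2 = density_properties[OF g, folded P2_def]
  have less_iff: "f x < g x \<longleftrightarrow> cut_bump'' x > 0" "g x < f x \<longleftrightarrow> cut_bump'' x < 0" for x
    using mass_pos pos_less_divide_eq[of mass 0 "cut_bump'' x"]
      pos_divide_less_eq[of mass "cut_bump'' x" 0] by (auto simp flip: diff)
  have alt_density: "alternate_on 1 2 f g"
    unfolding alternate_on_def less_iff
  proof
    fix x0 :: real assume x0: "x0 \<in> {1<..<2}"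
    then obtain x1 x2 where "x1 \<in> {x0<..<2}" "x2 \<in> {x0<..<2}" "bump'' x1 < 0" "bump'' x2 > 0"
      using alternate_on_bump'' unfolding alternate_on_def by blast
    then show "\<exists>x1\<in>{x0<..<2}. \<exists>x2\<in>{x0<..<2}. 0 < cut_bump'' x1 \<and> cut_bump'' x2 < 0"
      \<comment> \<open>The witnesses swap roles: \<open>f < g\<close> holds where
        \<open>bump''\<close> is positive.\<close>
      using x0 by (intro bexI[of _ x2] bexI[of _ x1]) (auto simp: cut_bump''_def)
  qed
  have cdf_diff: "cdf P2 x - cdf P1 x = bump' x / mass" if x: "x \<in> {1..2}" for x
  proof -
    have int: "integrable lborel (\<lambda>t. f t * indicator {..x} t)"
      "integrable lborel (\<lambda>t. g t * indicator {..x} t)"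
      by (intro integrable_real_mult_indicator; simp add: f_def g_def integrable_cut_bump''_parts)+
    have "cdf P2 x - cdf P1 x = (\<integral>t. g t * indicator {..x} t - f t * indicator {..x} t \<partial>lborel)"
      using int by (simp add: P1 P2)
    also have "\<dots> = (\<integral>t. cut_bump'' t * indicator {..x} t / mass \<partial>lborel)"
      using diff by (simp flip: left_diff_distrib)
    also have "\<dots> = bump' x / mass"
      using has_bochner_integral_cut_bump''_atMost[OF x] by (simp add: has_bochner_integral_iff)
    finally show ?thesis .
  qed
  have cdf_less_iff: "cdf P1 x < cdf P2 x \<longleftrightarrow> bump' x > 0" "cdf P2 x < cdf P1 x \<longleftrightarrow> bump' x < 0"
    if "x \<in> {1..2}" for x
    using mass_pos pos_less_divide_eq[of mass 0 "bump' x"]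
      pos_divide_less_eq[of mass "bump' x" 0] by (auto simp flip: cdf_diff[OF that])
  have alt_cdf: "alternate_on 1 2 (cdf P1) (cdf P2)"
    unfolding alternate_on_def
  proof
    fix x0 :: real assume x0: "x0 \<in> {1<..<2}"
    then obtain x1 x2 where "x1 \<in> {x0<..<2}" "x2 \<in> {x0<..<2}" "bump' x1 < 0" "bump' x2 > 0"
      using alternate_on_bump' unfolding alternate_on_def by blast
    then show "\<exists>x1\<in>{x0<..<2}. \<exists>x2\<in>{x0<..<2}. cdf P1 x1 < cdf P2 x1 \<and> cdf P1 x2 > cdf P2 x2"
      using x0 by (intro bexI[of _ x2] bexI[of _ x1]) (auto simp: cdf_less_iff)
  qed
  have moment_less: "moment k P1 < moment k P2" if "k \<ge> 2" for k
  proof -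
    have "moment k P2 - moment k P1 = (\<integral>x. g x * x ^ k - f x * x ^ k \<partial>lborel)"
      using integrable_power_mult[OF f(1) f(3)] integrable_power_mult[OF g(1) g(3)]
      by (simp add: P1 P2)
    also have "\<dots> = (\<integral>x. x ^ k * cut_bump'' x / mass \<partial>lborel)"
      using diff by (simp add: mult.commute flip: left_diff_distrib)
    also have "\<dots> > 0"
      \<comment> \<open>The simplifier must keep \<open>k - 2 + 2\<close> as a sum in order to
        reduce it to \<open>k\<close>.\<close>
      using integral_power_cut_bump''_pos[of "k - 2"] mass_pos that
      by (simp del: add_2_eq_Suc')
    finally show ?thesis by simp
  qed
  have "P1 \<preceq>\<^sub>t\<^sub>a\<^sub>i\<^sub>l P2"
  proof -
    \<comment> \<open>Only the exponents 0 and 1 escape \<open>moment_less\<close>.\<close>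
    have "{k. \<not> moment k P1 \<le> moment k P2} \<subseteq> {..<2}"
      using moment_less by (force simp: not_le)
    then show ?thesis
      unfolding tail_le_def using P1(5) P2(5) finite_subset by blast
  qed
  moreover have "\<not> P2 \<preceq>\<^sub>t\<^sub>a\<^sub>i\<^sub>l P1"
  proof -
    have "{2..} \<subseteq> {k. \<not> moment k P2 \<le> moment k P1}"
      using moment_less by (force simp: not_le)
    then have "infinite {k. \<not> moment k P2 \<le> moment k P1}"
      using infinite_Ici finite_subset by blast
    \<comment> \<open>The strict inequality of second moments excludes the case
      \<open>P2 = P1\<close> of the order.\<close>
    then show ?thesis
      unfolding tail_le_def using moment_less[of 2] by auto
  qed
  ultimately show ?thesis
    using P1(1-4) P2(1-4) alt_density alt_cdf
    by (intro exI[of _ 2] exI[of _ P1] exI[of _ P2] exI[of _ f] exI[of _ g])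
      (auto simp: tail_less_def)
qed

end
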